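(* Suppose that for some $\gamma$ $$ \operatorname{Re}\left\{\exp\int_0^z\frac{\varphi(t)-1}{t}\,dt\right\}\geq\gamma>0\quad\text{for all } z\in\mathbb{D}. $$ Then $\mathcal{S}^*(\varphi)\subset\mathcal{G}_0$. Moreover, every $f\in\mathcal{S}^*(\varphi)$ generates a semigroup $\{u(t,\cdot)\}_{t\ge0}$ which satisfies $$ |u(t,z)|\leq e^{-t\gamma}|z|\quad\text{for all } t\ge0,\ z\in\mathbb{D}. $$
   Context: $\mathbb{D}=\{z\in\mathbb{C}:|z|<1\}$. $\mathcal{A}$ is the class of functions $f$ holomorphic in $\mathbb{D}$ with $f(0)=0$, $f'(0)=1$, and $\mathcal{S}\subset\mathcal{A}$ the subclass of univalent functions. $g\prec h$ (subordination) means $g=h\circ\omega$ for some holomorphic $\omega:\mathbb{D}\to\mathbb{D}$ with $\omega(0)=0$. Throughout, $\varphi$ is an analytic univalent function on $\mathbb{D}$ with $\varphi(0)=1$ such that $\varphi(\mathbb{D})$ is starlike with respect to $1$, lies in the right half-plane and is symmetric about the real axis, and $$\mathcal{S}^*(\varphi)=\left\{f\in\mathcal{S}:\frac{zf'(z)}{f(z)}\prec\varphi(z)\right\}.$$ $\mathcal{G}_0=\{f\in\mathcal{A}: f(z)=zp(z),\ \operatorname{Re}p(z)>0 \text{ for } z\in\mathbb{D}\}$; its elements are infinitesimal generators: the semigroup generated by $f\in\mathcal{G}_0$ is the family $\{u(t,\cdot)\}_{t\ge0}$ of holomorphic self-maps of $\mathbb{D}$ given by the unique solution of $\frac{\partial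 u(t,z)}{\partial t}+f(u(t,z))=0$, $u(0,z)=z$. *)

theory Defs
  imports "HOL-Complex_Analysis.Complex_Analysis"
begin

abbreviation unit_disc :: "complex set" where
  "unit_disc \<equiv> ball 0 1"

definition class_A :: "(complex \<Rightarrow> complex) set" where
  "class_A = {f. f holomorphic_on unit_disc \<and> f 0 = 0 \<and> deriv f 0 = 1}"

definition class_S :: "(complex \<Rightarrow> complex) set" where
  "class_S = {f \<in> class_A. inj_on f unit_disc}"

definition subordinate :: "(complex \<Rightarrow> complex) \<Rightarrow> (complex \<Rightarrow> complex) \<Rightarrow> bool" where
  "subordinate g h \<longleftrightarrow>
     (\<exists>\<omega>. \<omega> holomorphic_on unit_disc \<and> \<omega> ` unit_disc \<subseteq> unit_disc \<and> \<omega> 0 = 0 \<and>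
          (\<forall>z\<in>unit_disc. g z = h (\<omega> z)))"

definition admissible_phi :: "(complex \<Rightarrow> complex) \<Rightarrow> bool" where
  "admissible_phi \<phi> \<longleftrightarrow>
     \<phi> holomorphic_on unit_disc \<and> inj_on \<phi> unit_disc \<and> \<phi> 0 = 1 \<and>
     (\<forall>w\<in>\<phi> ` unit_disc. closed_segment 1 w \<subseteq> \<phi> ` unit_disc) \<and>
     (\<forall>w\<in>\<phi> ` unit_disc. Re w > 0) \<and>
     cnj ` (\<phi> ` unit_disc) = \<phi> ` unit_disc"

(* z f'(z) / f(z) with its removable singularity at 0 filled in; the limit there is 1 because
   f 0 = 0 and f'(0) = 1, whereas the bare HOL quotient would be 0 / 0 = 0. *)
definition log_deriv_quotient :: "(complex \<Rightarrow> complex) \<Rightarrow> complex \<Rightarrow> complex" where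
  "log_deriv_quotient f z = (if z = 0 then 1 else z * deriv f z / f z)"

definition starlike_class :: "(complex \<Rightarrow> complex) \<Rightarrow> (complex \<Rightarrow> complex) set" where
  "starlike_class \<phi> = {f \<in> class_S. subordinate (log_deriv_quotient f) \<phi>}"

definition class_G0 :: "(complex \<Rightarrow> complex) set" where
  "class_G0 = {f \<in> class_A. \<exists>p. p holomorphic_on unit_disc \<and>
                 (\<forall>z\<in>unit_disc. f z = z * p z \<and> Re (p z) > 0)}"

(* The integral runs along the segment from 0 to z. The HOL value 0 of the integrand at the
   removable singularity t = 0 does not affect it. *)
definition exp_integral :: "(complex \<Rightarrow> complex) \<Rightarrow> complex \<Rightarrow> complex" where
  "exp_integral \<phi> z = exp (contour_integral (linepath 0 z) (\<lambda>t. (\<phi> t - 1) / t))"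

(* The time derivative is one-sided at t = 0; values of u for t < 0 or z outside the disc
   are irrelevant. *)
definition solves_semigroup_ode ::
    "(complex \<Rightarrow> complex) \<Rightarrow> (real \<Rightarrow> complex \<Rightarrow> complex) \<Rightarrow> bool" where
  "solves_semigroup_ode f u \<longleftrightarrow>
     (\<forall>z\<in>unit_disc. u 0 z = z \<and>
        (\<forall>t\<ge>0. u t z \<in> unit_disc \<and>
           ((\<lambda>s. u s z) has_vector_derivative - f (u t z)) (at t within {0..})))"

definition generates_semigroup ::
    "(complex \<Rightarrow> complex) \<Rightarrow> (real \<Rightarrow> complex \<Rightarrow> complex) \<Rightarrow> bool" where
  "generates_semigroup f u \<longleftrightarrow>
     (\<forall>t\<ge>0. u t holomorphic_on unit_disc \<and> u t ` unit_disc \<subseteq> unit_disc) \<and>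
     solves_semigroup_ode f u \<and>
     (\<forall>v. solves_semigroup_ode f v \<longrightarrow> (\<forall>t\<ge>0. \<forall>z\<in>unit_disc. v t z = u t z))"

end

theory Submission
  imports Defs
begin

text \<open>
  Write \<open>f(z) = z p(z)\<close>. Both claims follow from the single estimate \<open>Re p \<ge> \<gamma>\<close> on the disc.

  \<^emph>\<open>The estimate.\<close> Put \<open>h = \<phi> - 1\<close>, an injective function with \<open>h(0) = 0\<close> whose image is starlike with
  respect to \<open>0\<close>. The exponent in the hypothesis is the solution \<open>H\<close> of \<open>z H' = h\<close>, \<open>H(0) = 0\<close>. If \<open>z f'/f = \<phi> \<circ> \<omega>\<close>,
  then \<open>p = exp G\<close> where \<open>z G' = h \<circ> \<omega>\<close>, \<open>G(0) = 0\<close>, and \<open>|\<omega>(z)| \<le> |z|\<close> by the Schwarz lemma. The heart of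
  the matter is the comparison \<open>subordinate_support_le\<close>: no real linear functional takes at a value of
  \<open>G\<close> more than its supremum over the values of \<open>H\<close>. By separation, \<open>G\<close> takes its values in every closed convex set that contains
  the values of \<open>H\<close>. This suffices, because the logarithms of the points of the half-plane \<open>Re w \<ge> \<gamma>\<close>,
  taken in the strip \<open>|Im w| \<le> \<pi>/2\<close>, form such a set: in the open strip they are given by \<open>Re w + ln (cos (Im w)) \<ge> ln \<gamma>\<close>,
  and \<open>ln \<circ> cos\<close> is concave.

  \<^emph>\<open>The semigroup.\<close> The function \<open>K(z) = z exp B(z)\<close> with \<open>z B' = 1/p - 1\<close> satisfies \<open>f K' = K\<close>, so it turns the
  equation \<open>u' = - f(u)\<close> into \<open>K(u)' = - K(u)\<close>. Since \<open>Re (z K'/K) = Re (1/p) > 0\<close>, the function \<open>K\<close> is injective and its image is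
  starlike, so \<open>u(t, z) = K\<^sup>-\<^sup>1(e\<^sup>-\<^sup>t K(z))\<close> is defined for all \<open>t \<ge> 0\<close>; holomorphy and
  uniqueness can be read off from this formula. The decay is \<open>(|u|\<^sup>2)' = - 2 |u|\<^sup>2 Re p(u) \<le> - 2 \<gamma> |u|\<^sup>2\<close>.
\<close>

section \<open>Holomorphic preliminaries\<close>

lemma has_real_derivative_Re_on_reals:
  assumes "(F has_field_derivative D) (at (complex_of_real x))"
  shows "((\<lambda>t. Re (F (of_real t))) has_real_derivative Re D) (at x)"
  using bounded_linear.has_vector_derivative[OF bounded_linear_Re
      has_vector_derivative_real_field[OF assms, of UNIV]]
  by (simp add: has_real_derivative_iff_has_vector_derivative)

lemma has_real_derivative_cmod_power2:
  assumes "(y has_vector_derivative y') (at x)"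
  shows "((\<lambda>t. (cmod (y t))\<^sup>2) has_real_derivative 2 * Re (cnj (y x) * y')) (at x)"
proof -
  have "((\<lambda>t. Re (y t)) has_real_derivative Re y') (at x)"
       "((\<lambda>t. Im (y t)) has_real_derivative Im y') (at x)"
    using bounded_linear.has_vector_derivative[OF bounded_linear_Re assms]
          bounded_linear.has_vector_derivative[OF bounded_linear_Im assms]
    by (simp_all add: has_real_derivative_iff_has_vector_derivative)
  then have "((\<lambda>t. Re (y t) * Re (y t) + Im (y t) * Im (y t)) has_real_derivative
      (Re y' * Re (y x) + Re y' * Re (y x)) + (Im y' * Im (y x) + Im y' * Im (y x))) (at x)"
    by (intro DERIV_add DERIV_mult)
  then show ?thesis
    unfolding cmod_power2 by (simp add: power2_eq_square algebra_simps)
qed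

lemma holomorphic_factor_zero:
  assumes "g holomorphic_on unit_disc" "g 0 = 0"
  obtains q where "q holomorphic_on unit_disc" "\<And>z. g z = z * q z" "q 0 = deriv g 0"
proof
  show "(\<lambda>z. if z = 0 then deriv g 0 else (g z - g 0) / (z - 0)) holomorphic_on unit_disc"
    by (rule pole_lemma_open[OF assms(1)]) simp
qed (use assms in auto)

text \<open>The function \<open>B\<close> is the integral of \<open>g(t)/t\<close> from \<open>0\<close> to \<open>z\<close>. Keeping \<open>z B'\<close> instead of \<open>B'\<close> avoids
  a case distinction at the removable singularity.\<close>

lemma Euler_primitive:
  assumes "g holomorphic_on unit_disc" "g 0 = 0"
  obtains B where "B holomorphic_on unit_disc" "B 0 = 0" "\<And>z. z \<in> unit_disc \<Longrightarrow> z * deriv B z = g z"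
proof -
  obtain q where q: "q holomorphic_on unit_disc" "\<And>z. g z = z * q z"
    using holomorphic_factor_zero[OF assms] by metis
  obtain B where B: "\<And>z. z \<in> unit_disc \<Longrightarrow> (B has_field_derivative q z) (at z within unit_disc)"
    using holomorphic_convex_primitive'[OF convex_ball open_ball q(1)] by blast
  have B': "(B has_field_derivative q z) (at z)" if "z \<in> unit_disc" for z
    using B[OF that] that by (simp add: at_within_open[OF _ open_ball])
  show thesis
  proof
    show "(\<lambda>z. B z - B 0) holomorphic_on unit_disc"
      using B by (intro holomorphic_intros) (meson holomorphic_on_def field_differentiable_def)
    fix z :: complex assume z: "z \<in> unit_disc"
    have "((\<lambda>z. B z - B 0) has_field_derivative q z) (at z)"
      using B'[OF z] by (auto intro!: derivative_eq_intros)
    then show "z * deriv (\<lambda>z. B z - B 0) z = g z"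
      using q(2) DERIV_imp_deriv by metis
  qed simp
qed

section \<open>Subordination under a starlike function\<close>

text \<open>On the preimage under \<open>h\<close> of a ray from \<open>0\<close> the modulus grows with the distance of the value from \<open>0\<close>.
  The map \<open>h\<^sup>-\<^sup>1 \<circ> (s h)\<close> is a self-map of the disc, so the Schwarz lemma gives \<open>\<le>\<close>. Equality would make it a
  rotation; then \<open>|h|\<close> would shrink by the factor \<open>s\<close> along an orbit on a circle, which is impossible at
  the point of the circle where \<open>|h|\<close> is least.\<close>

lemma starlike_radial_strict_mono:
  assumes h: "h holomorphic_on unit_disc" "inj_on h unit_disc" "h 0 = 0"
    and star: "\<And>z s. z \<in> unit_disc \<Longrightarrow> 0 \<le> s \<Longrightarrow> s \<le> 1 \<Longrightarrow> of_real s * h z \<in> h ` unit_disc"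
    and w: "w \<in> unit_disc" "w \<noteq> 0" and v: "v \<in> unit_disc" "h v = of_real s * h w"
    and s: "0 \<le> s" "s < 1"
  shows "cmod v < cmod w"
proof -
  obtain k where k: "k holomorphic_on h ` unit_disc"
     "\<And>z. z \<in> unit_disc \<Longrightarrow> deriv h z * deriv k (h z) = 1" "\<And>z. z \<in> unit_disc \<Longrightarrow> k (h z) = z"
    using holomorphic_has_inverse[OF h(1) open_ball h(2)] by blast
  define g where "g = (\<lambda>z. k (of_real s * h z))"
  have sh: "of_real s * h z \<in> h ` unit_disc" if "z \<in> unit_disc" for z
    using star[OF that] s by simp
  have hg: "h (g z) = of_real s * h z" and gD: "g z \<in> unit_disc" if "z \<in> unit_disc" for z
    using sh[OF that] k(3) unfolding g_def by (metis (no_types, lifting) imageE)+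
  have hol: "g holomorphic_on unit_disc"
    unfolding g_def using sh h(1)
    by (intro holomorphic_on_compose_gen[OF _ k(1), unfolded o_def] holomorphic_intros) auto
  have g0: "g 0 = 0" using k(3)[of 0] h(3) by (simp add: g_def)
  have gw: "g w = v" using k(3)[OF v(1)] v(2) by (simp add: g_def)
  have g_lt: "cmod (g z) < 1" if "cmod z < 1" for z
    using gD[of z] that by simp
  note Schwarz = Schwarz_Lemma[OF hol g0 g_lt]
  have "cmod v \<le> cmod w"
    using Schwarz(1)[of w] w gw by simp
  moreover have "cmod v \<noteq> cmod w"
  proof
    assume "cmod v = cmod w"
    then obtain \<alpha> where \<alpha>: "\<And>z. cmod z < 1 \<Longrightarrow> g z = \<alpha> * z" "cmod \<alpha> = 1"
      using Schwarz(3)[of 0] w gw by (metis mem_ball_0 norm_zero zero_less_one)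
    have h0: "h z = 0 \<longleftrightarrow> z = 0" if "z \<in> unit_disc" for z
      using h that by (metis centre_in_ball inj_on_eq_iff zero_less_one)
    define C where "C = sphere (0::complex) (cmod w)"
    have CD: "C \<subseteq> unit_disc" using w by (auto simp: C_def)
    have "continuous_on C (\<lambda>z. cmod (h z))"
      using h(1) CD by (intro continuous_intros) (meson holomorphic_on_imp_continuous_on continuous_on_subset)
    moreover have "compact C" "w \<in> C" by (auto simp: C_def)
    ultimately obtain z where z: "z \<in> C" "\<And>y. y \<in> C \<Longrightarrow> cmod (h z) \<le> cmod (h y)"
      using continuous_attains_inf[of C "\<lambda>z. cmod (h z)"] by blast
    have zD: "z \<in> unit_disc" "z \<noteq> 0" using z(1) CD w(2) by (auto simp: C_def)
    have "g z \<in> C" using \<alpha> z(1) zD by (auto simp: C_def norm_mult)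
    then have "cmod (h z) \<le> s * cmod (h z)"
      using z(2) hg[OF zD(1)] s by (metis abs_of_nonneg norm_mult norm_of_real)
    moreover have "cmod (h z) > 0" using h0[OF zD(1)] zD(2) by simp
    ultimately show False using s(2) by simp
  qed
  ultimately show ?thesis by simp
qed

text \<open>Let \<open>\<sigma>(m) = h\<^sup>-\<^sup>1(m e)\<close> be the preimage of the ray in direction \<open>e\<close>; by
  \<open>starlike_radial_strict_mono\<close>, \<open>|\<sigma>|\<close> is increasing, and it takes every value in \<open>[0, 1)\<close>. On the circle
  \<open>|z| = |\<sigma>(m)|\<close> the functional \<open>Re (cnj e * G z)\<close> does not exceed \<open>Re (cnj e * H (\<sigma> m))\<close>. Informally: at a maximum point \<open>z\<close> of the functional on the
  circle the angular derivative vanishes, so \<open>z G' = h (\<omega> z)\<close> is a real multiple \<open>a e\<close> of \<open>e\<close>. Since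
  \<open>|\<omega> z| \<le> |z| = |\<sigma>(m)|\<close>, monotonicity forces \<open>a \<le> m\<close>, whereas \<open>\<sigma> H'(\<sigma>) = m e\<close>. Hence the maximum
  for \<open>G\<close> grows with the radius no faster than the value of \<open>H\<close> along \<open>\<sigma>\<close>, and both start at \<open>0\<close>.

  To avoid differentiating a maximum function, the difference of the two sides, lowered by \<open>\<delta> m\<close> with
  \<open>\<delta> > 0\<close>, is maximised over the circle parameter \<open>c\<close> and over \<open>m\<close> simultaneously. A maximum at \<open>m > 0\<close> would require
  \<open>a > m\<close>; so it is at \<open>m = 0\<close>, where the difference is \<open>0\<close>, and \<open>\<delta>\<close> is arbitrary.\<close>

lemma subordinate_support_le:
  fixes h H G \<omega> :: "complex \<Rightarrow> complex"
  assumes h: "h holomorphic_on unit_disc" "inj_on h unit_disc" "h 0 = 0"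
    and star: "\<And>z s. z \<in> unit_disc \<Longrightarrow> 0 \<le> s \<Longrightarrow> s \<le> 1 \<Longrightarrow> of_real s * h z \<in> h ` unit_disc"
    and H: "H holomorphic_on unit_disc" "H 0 = 0" "\<And>z. z \<in> unit_disc \<Longrightarrow> z * deriv H z = h z"
    and G: "G holomorphic_on unit_disc" "G 0 = 0" "\<And>z. z \<in> unit_disc \<Longrightarrow> z * deriv G z = h (\<omega> z)"
    and \<omega>: "\<And>z. z \<in> unit_disc \<Longrightarrow> cmod (\<omega> z) \<le> cmod z"
    and z: "z \<in> unit_disc"
  shows "\<exists>w\<in>unit_disc. Re (cnj e * G z) \<le> Re (cnj e * H w)"
proof (cases "e = 0")
  case True
  then show ?thesis using z by auto
next
  case False
  have op: "open (h ` unit_disc)"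
    by (rule open_mapping_thm3[OF h(1) open_ball h(2)])
  obtain k where k: "k holomorphic_on h ` unit_disc"
     "\<And>z. z \<in> unit_disc \<Longrightarrow> deriv h z * deriv k (h z) = 1" "\<And>z. z \<in> unit_disc \<Longrightarrow> k (h z) = z"
    using holomorphic_has_inverse[OF h(1) open_ball h(2)] by blast
  define I where "I = {m. 0 \<le> m \<and> of_real m * e \<in> h ` unit_disc}"
  define \<sigma> where "\<sigma> = (\<lambda>m::real. k (of_real m * e))"
  have \<sigma>D: "\<sigma> m \<in> unit_disc" and h\<sigma>: "h (\<sigma> m) = of_real m * e" if "m \<in> I" for m
    using that k(3) unfolding I_def \<sigma>_def by auto
  have \<sigma>0: "\<sigma> 0 = 0"
    using k(3)[of 0] h(3) by (simp add: \<sigma>_def)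
  have h0: "h z = 0 \<longleftrightarrow> z = 0" if "z \<in> unit_disc" for z
    using h that by (metis centre_in_ball inj_on_eq_iff zero_less_one)
  have \<sigma>_nz: "\<sigma> m \<noteq> 0" if "m \<in> I" "m > 0" for m
    using h\<sigma>[OF that(1)] h(3) that(2) False by auto
  have I_down: "m' \<in> I" if "m \<in> I" "0 \<le> m'" "m' \<le> m" for m m'
  proof (cases "m = 0")
    case True
    then show ?thesis using that by auto
  next
    case False
    then have "of_real (m' / m) * h (\<sigma> m) \<in> h ` unit_disc"
      using that by (intro star \<sigma>D) (auto simp: field_simps)
    then show ?thesis
      using False that h\<sigma>[OF that(1)] by (simp add: I_def)
  qed
  have strict: "cmod (\<sigma> m') < cmod v" if "v \<in> unit_disc" "h v = of_real m * e" "0 \<le> m'" "m' < m" for v m m'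
  proof -
    have mI: "m \<in> I" using that unfolding I_def by (metis (mono_tags, lifting) imageI mem_Collect_eq less_eq_real_def order_trans)
    then have m'I: "m' \<in> I" using I_down that by simp
    have "h (\<sigma> m') = of_real (m' / m) * h v"
      using h\<sigma>[OF m'I] that by (simp add: field_simps)
    moreover have "v \<noteq> 0" using that h(3) False by auto
    ultimately show ?thesis
      using that by (intro starlike_radial_strict_mono[OF h star that(1) _ \<sigma>D[OF m'I], of "m' / m"]) auto
  qed
  have cont_\<sigma>: "continuous_on I \<sigma>"
    unfolding \<sigma>_def
    by (rule continuous_on_compose2[OF holomorphic_on_imp_continuous_on[OF k(1)]])
       (auto intro!: continuous_intros simp: I_def)
  have \<sigma>': "(\<sigma> has_vector_derivative deriv k (of_real m * e) * e) (at m)"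
    and \<sigma>'c: "((\<lambda>x. k (x * e)) has_field_derivative deriv k (of_real m * e) * e) (at (of_real m))"
    if "m \<in> I" for m
  proof -
    have "(k has_field_derivative deriv k (of_real m * e)) (at (of_real m * e))"
      using holomorphic_derivI[OF k(1) op] that by (auto simp: I_def)
    then show *: "((\<lambda>x. k (x * e)) has_field_derivative deriv k (of_real m * e) * e) (at (of_real m))"
      by (rule DERIV_chain2) (auto intro!: derivative_eq_intros)
    show "(\<sigma> has_vector_derivative deriv k (of_real m * e) * e) (at m)"
      unfolding \<sigma>_def by (rule has_vector_derivative_real_field[OF *])
  qed
  have key: "Re (cnj e * (G (c * \<sigma> m) - H (\<sigma> m))) \<le> 0" if m: "m \<in> I" and c: "cmod c = 1" for m c
  proof -
    have bound: "Re (cnj e * (G (c * \<sigma> m) - H (\<sigma> m))) \<le> \<delta> * m" if \<delta>: "\<delta> > 0" for \<delta>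
    proof -
      define \<Psi> where "\<Psi> = (\<lambda>c m. Re (cnj e * (G (c * \<sigma> m) - H (\<sigma> m))) - \<delta> * m)"
      have sub: "{0..m} \<subseteq> I" using I_down m by auto
      have ballc: "c * \<sigma> r \<in> unit_disc" if "cmod c = 1" "r \<in> I" for c r
        using that \<sigma>D[of r] by (simp add: norm_mult)
      have "continuous_on (sphere 0 1 \<times> {0..m}) (\<lambda>x. \<Psi> (fst x) (snd x))"
        unfolding \<Psi>_def
        using sub \<sigma>D ballc
        by (intro continuous_intros continuous_on_compose2[OF cont_\<sigma>]
              continuous_on_compose2[OF holomorphic_on_imp_continuous_on[OF G(1)]]
              continuous_on_compose2[OF holomorphic_on_imp_continuous_on[OF H(1)]]) 
           (auto simp: subset_iff)
      moreover have "compact (sphere (0::complex) 1 \<times> {0..m})"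
        by (intro compact_Times) auto
      moreover have "(c, m) \<in> sphere 0 1 \<times> {0..m}" using m c by (auto simp: I_def)
      ultimately obtain x where x: "x \<in> sphere 0 1 \<times> {0..m}"
         "\<And>y. y \<in> sphere 0 1 \<times> {0..m} \<Longrightarrow> \<Psi> (fst y) (snd y) \<le> \<Psi> (fst x) (snd x)"
        using continuous_attains_sup[of "sphere 0 1 \<times> {0..m}" "\<lambda>x. \<Psi> (fst x) (snd x)"] by blast
      obtain c0 m0 where x_eq: "x = (c0, m0)" by (cases x)
      have c0: "cmod c0 = 1" and m0: "0 \<le> m0" "m0 \<le> m" "m0 \<in> I" using x x_eq sub by auto
      have max: "\<Psi> d r \<le> \<Psi> c0 m0" if "cmod d = 1" "0 \<le> r" "r \<le> m" for d r
        using x(2)[of "(d, r)"] that x_eq by simp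
      have "m0 = 0"
      proof (rule ccontr)
        assume "m0 \<noteq> 0"
        then have m0p: "m0 > 0" using m0 by simp
        define s where "s = \<sigma> m0"
        define s' where "s' = deriv k (of_real m0 * e) * e"
        define g where "g = h (\<omega> (c0 * s))"
        have sD: "s \<in> unit_disc" and snz: "s \<noteq> 0" and csD: "c0 * s \<in> unit_disc"
          using \<sigma>D \<sigma>_nz ballc m0 m0p c0 by (auto simp: s_def)
        have G': "(G has_field_derivative deriv G (c0 * s)) (at (c0 * s))"
          by (rule holomorphic_derivI[OF G(1) open_ball csD])
        have H': "(H has_field_derivative deriv H s) (at s)"
          by (rule holomorphic_derivI[OF H(1) open_ball sD])
        have Gg: "c0 * s * deriv G (c0 * s) = g"
          using G(3)[OF csD] by (simp add: g_def)
        have Hh: "s * deriv H s = of_real m0 * e"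
          using H(3)[OF sD] h\<sigma>[OF m0(3)] by (simp add: s_def)
        \<comment> \<open>The derivative of \<open>\<Psi>\<close> under rotation of \<open>c0\<close> vanishes, so \<open>g\<close> is a real multiple of \<open>e\<close>.\<close>
        have "Im (cnj e * g) = 0"
        proof -
          have "((\<lambda>x. cnj e * (G (c0 * exp (\<i> * x) * s) - H s) - of_real (\<delta> * m0)) has_field_derivative
                   cnj e * (deriv G (c0 * s) * (c0 * \<i> * s))) (at (of_real 0))"
          proof -
            have "((\<lambda>x. c0 * exp (\<i> * x) * s) has_field_derivative c0 * \<i> * s) (at (of_real 0))"
              by (auto intro!: derivative_eq_intros)
            then have "((\<lambda>x. G (c0 * exp (\<i> * x) * s)) has_field_derivative deriv G (c0 * s) * (c0 * \<i> * s)) (at (of_real 0))"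
              using G' by (intro DERIV_chain2[where f = G]) auto
            then show ?thesis by (auto intro!: derivative_eq_intros)
          qed
          from has_real_derivative_Re_on_reals[OF this]
          have "((\<lambda>t. \<Psi> (c0 * cis t) m0) has_real_derivative Re (cnj e * (deriv G (c0 * s) * (c0 * \<i> * s)))) (at 0)"
            by (simp add: \<Psi>_def s_def cis_conv_exp)
          then have "Re (cnj e * (deriv G (c0 * s) * (c0 * \<i> * s))) = 0"
            by (rule DERIV_local_max[where d = 1]) (use max m0 c0 in \<open>auto simp: norm_mult\<close>)
          moreover have "cnj e * (deriv G (c0 * s) * (c0 * \<i> * s)) = \<i> * (cnj e * g)"
            unfolding Gg[symmetric] by (simp add: mult_ac)
          ultimately show ?thesis by simp
        qed
        then have g_real: "cnj e * g = of_real (Re (cnj e * g))"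
          by (simp add: complex_eq_iff)
        \<comment> \<open>Decreasing \<open>m\<close> does not increase \<open>\<Psi>\<close>. As \<open>cnj e * g\<close> is real, the derivative in \<open>m\<close> factors.\<close>
        define A where "A = Re (cnj e * g) - m0 * (cmod e)\<^sup>2"
        have "A * Re (s' / s) \<ge> \<delta>"
        proof (rule ccontr)
          assume neg: "\<not> A * Re (s' / s) \<ge> \<delta>"
          have k': "((\<lambda>x. k (x * e)) has_field_derivative s') (at (of_real m0))"
            using \<sigma>'c[OF m0(3)] by (simp add: s'_def)
          have ks: "k (of_real m0 * e) = s" by (simp add: s_def \<sigma>_def)
          have "((\<lambda>x. G (c0 * k (x * e))) has_field_derivative deriv G (c0 * s) * (c0 * s')) (at (of_real m0))"
            using G' k' ks by (intro DERIV_chain2[where f = G]) (auto intro!: derivative_eq_intros)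
          moreover have "((\<lambda>x. H (k (x * e))) has_field_derivative deriv H s * s') (at (of_real m0))"
            using H' k' ks by (intro DERIV_chain2[where f = H]) auto
          ultimately have "((\<lambda>x. cnj e * (G (c0 * k (x * e)) - H (k (x * e))) - of_real \<delta> * x) has_field_derivative
              cnj e * (deriv G (c0 * s) * (c0 * s') - deriv H s * s') - of_real \<delta>) (at (of_real m0))"
            by (auto intro!: derivative_eq_intros)
          from has_real_derivative_Re_on_reals[OF this]
          have "(\<Psi> c0 has_real_derivative
              Re (cnj e * (deriv G (c0 * s) * (c0 * s') - deriv H s * s')) - \<delta>) (at m0)"
            by (simp add: \<Psi>_def[abs_def] \<sigma>_def)
          moreover have "cnj e * (deriv G (c0 * s) * (c0 * s') - deriv H s * s') = of_real A * (s' / s)"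
          proof -
            have "cnj e * (deriv G (c0 * s) * (c0 * s') - deriv H s * s')
                = (cnj e * (c0 * s * deriv G (c0 * s)) - cnj e * (s * deriv H s)) * (s' / s)"
              using snz by (simp add: field_simps)
            also have "cnj e * (s * deriv H s) = of_real (m0 * (cmod e)\<^sup>2)"
              unfolding Hh by (simp add: complex_norm_square mult_ac del: of_real_power)
            finally show ?thesis
              unfolding Gg using g_real by (simp add: A_def)
          qed
          ultimately have "(\<Psi> c0 has_real_derivative A * Re (s' / s) - \<delta>) (at m0)"
            by (simp only: times_complex.sel Re_complex_of_real Im_complex_of_real mult_zero_left diff_zero)
          then obtain \<eta> where \<eta>: "\<eta> > 0" "\<And>t. t > 0 \<Longrightarrow> t < \<eta> \<Longrightarrow> \<Psi> c0 m0 < \<Psi> c0 (m0 - t)"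
            using DERIV_neg_dec_left[of "\<Psi> c0"] neg by (metis diff_less_0_iff_less not_le)
          define t where "t = min m0 (\<eta> / 2)"
          have "t > 0" "t < \<eta>" "t \<le> m0" using \<eta>(1) m0p by (auto simp: t_def)
          then show False using \<eta>(2)[of t] max[OF c0, of "m0 - t"] m0 by force
        qed
        \<comment> \<open>\<open>Re (s' / s)\<close> is the logarithmic derivative of the increasing function \<open>|\<sigma>|\<close>.\<close>
        moreover have "Re (s' / s) \<ge> 0"
        proof -
          have "((\<lambda>t. (cmod (\<sigma> t))\<^sup>2) has_real_derivative 2 * Re (cnj s * s')) (at m0)"
            using has_real_derivative_cmod_power2[OF \<sigma>'[OF m0(3)]] by (simp add: s_def s'_def)
          have "2 * Re (cnj s * s') \<ge> 0"
          proof (rule ccontr)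
            assume "\<not> 2 * Re (cnj s * s') \<ge> 0"
            then obtain \<eta> where \<eta>: "\<eta> > 0" "\<And>t. t > 0 \<Longrightarrow> t < \<eta> \<Longrightarrow> (cmod (\<sigma> m0))\<^sup>2 < (cmod (\<sigma> (m0 - t)))\<^sup>2"
              using DERIV_neg_dec_left[OF \<open>((\<lambda>t. (cmod (\<sigma> t))\<^sup>2) has_real_derivative _) _\<close>] by (metis not_le)
            define t where "t = min m0 (\<eta> / 2)"
            have t: "t > 0" "t < \<eta>" "t \<le> m0" using \<eta>(1) m0p by (auto simp: t_def)
            then have "cmod (\<sigma> (m0 - t)) < cmod (\<sigma> m0)"
              using h\<sigma>[OF m0(3)] \<sigma>D[OF m0(3)] by (intro strict[of _ m0]) auto
            then show False using \<eta>(2)[OF t(1,2)] power2_less_imp_less[of "cmod (\<sigma> m0)" "cmod (\<sigma> (m0 - t))"] by simp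
          qed
          moreover have "s' / s = cnj s * s' / of_real ((cmod s)\<^sup>2)"
            using snz by (simp add: complex_norm_square field_simps del: of_real_power)
          ultimately show ?thesis by (simp only: Re_divide_of_real) (simp add: zero_le_divide_iff)
        qed
        ultimately have "A > 0"
          using \<delta> by (metis less_le_trans mult_nonpos_nonneg not_le)
        define a where "a = Re (cnj e * g) / (cmod e)\<^sup>2"
        have "m0 < a"
          using \<open>A > 0\<close> False by (simp add: A_def a_def field_simps)
        have "g = of_real a * e"
        proof -
          have "e * (cnj e * g) = of_real (Re (cnj e * g)) * e"
            using g_real by simp
          moreover have "e * (cnj e * g) = of_real ((cmod e)\<^sup>2) * g"
            by (simp only: complex_norm_square mult.assoc)
          ultimately show ?thesis
            using False by (simp add: a_def field_simps)
        qed
        then have "cmod s < cmod (\<omega> (c0 * s))"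
          unfolding s_def g_def using \<open>m0 < a\<close> m0 \<omega>[OF csD] csD 
          by (intro strict[of _ a]) (auto simp: s_def)
        then show False
          using \<omega>[OF csD] c0 by (simp add: norm_mult)
      qed
      then have "\<Psi> c m \<le> 0"
        using max[OF c, of m] m \<sigma>0 G(2) H(2) by (simp add: I_def \<Psi>_def)
      then show ?thesis by (simp add: \<Psi>_def)
    qed
    show ?thesis
    proof (rule field_le_epsilon)
      fix \<epsilon> :: real assume "\<epsilon> > 0"
      have "m \<ge> 0" using m by (simp add: I_def)
      then have "\<epsilon> / (m + 1) * m \<le> \<epsilon>" using \<open>\<epsilon> > 0\<close> by (simp add: field_simps)
      then show "Re (cnj e * (G (c * \<sigma> m) - H (\<sigma> m))) \<le> 0 + \<epsilon>"
        using bound[of "\<epsilon> / (m + 1)"] \<open>\<epsilon> > 0\<close> \<open>m \<ge> 0\<close> by simp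
    qed
  qed
  \<comment> \<open>The curve \<open>\<sigma>\<close> leaves every smaller closed disc: otherwise \<open>I\<close> would be compact, while \<open>I\<close> is open to the right.\<close>
  have "\<exists>m\<in>I. cmod (\<sigma> m) \<ge> cmod z"
  proof (rule ccontr)
    assume "\<not> ?thesis"
    then have lt: "cmod (\<sigma> m) < cmod z" if "m \<in> I" for m using that by force
    define C where "C = h ` cball 0 (cmod z)"
    have sub: "cball 0 (cmod z) \<subseteq> unit_disc" using z by auto
    have "compact C"
      unfolding C_def using h(1) sub
      by (intro compact_continuous_image compact_cball)
         (meson holomorphic_on_imp_continuous_on continuous_on_subset)
    have I_eq: "I = {0..} \<inter> (\<lambda>m. of_real m * e) -` C"
    proof (intro equalityI subsetI)
      fix m assume m: "m \<in> I"
      then have "of_real m * e \<in> C"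
        using lt[OF m] h\<sigma>[OF m] unfolding C_def by (metis less_imp_le imageI mem_cball_0)
      then show "m \<in> {0..} \<inter> (\<lambda>m. of_real m * e) -` C" using m by (simp add: I_def)
    qed (use sub in \<open>auto simp: I_def C_def\<close>)
    have "closed I"
      unfolding I_eq using \<open>compact C\<close>
      by (intro continuous_closed_preimage continuous_intros compact_imp_closed) auto
    moreover have "bounded I"
    proof -
      obtain b where b: "\<And>x. x \<in> C \<Longrightarrow> cmod x \<le> b"
        using compact_imp_bounded[OF \<open>compact C\<close>] unfolding bounded_iff by blast
      have "I \<subseteq> {0..b / cmod e}"
      proof
        fix m assume "m \<in> I"
        then have "cmod (of_real m * e) \<le> b" "m \<ge> 0" using b I_eq by auto
        then show "m \<in> {0..b / cmod e}" using False by (simp add: norm_mult field_simps)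
      qed
      then show ?thesis using bounded_subset bounded_closed_interval by blast
    qed
    ultimately have "compact I" by (simp add: compact_eq_bounded_closed)
    moreover have "0 \<in> I" using h(3) by (auto simp: I_def intro!: image_eqI[of _ _ 0])
    ultimately obtain M where M: "M \<in> I" "\<And>m. m \<in> I \<Longrightarrow> m \<le> M"
      using compact_attains_sup[of I] by blast
    have "open ((\<lambda>m::real. of_real m * e) -` (h ` unit_disc))"
      by (intro open_vimage op continuous_intros)
    then obtain \<epsilon> where \<epsilon>: "\<epsilon> > 0" "ball M \<epsilon> \<subseteq> (\<lambda>m::real. of_real m * e) -` (h ` unit_disc)"
      using M(1) unfolding I_def open_contains_ball by blast
    have "M + \<epsilon> / 2 \<in> ball M \<epsilon>" using \<epsilon>(1) by (simp add: dist_real_def)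
    then have "M + \<epsilon> / 2 \<in> I" using \<epsilon> M(1) by (auto simp: I_def)
    then show False using M(2) \<epsilon>(1) by force
  qed
  then obtain m1 where m1: "m1 \<in> I" "cmod (\<sigma> m1) \<ge> cmod z" by blast
  have "continuous_on {0..m1} (\<lambda>m. cmod (\<sigma> m))"
    using I_down[OF m1(1)] by (intro continuous_intros continuous_on_subset[OF cont_\<sigma>]) auto
  then obtain m where m: "0 \<le> m" "m \<le> m1" "cmod (\<sigma> m) = cmod z"
    using IVT'[of "\<lambda>m. cmod (\<sigma> m)" 0 "cmod z" m1] m1 \<sigma>0 by (auto simp: I_def)
  have mI: "m \<in> I" using I_down m1 m by blast
  obtain c where c: "cmod c = 1" "z = c * \<sigma> m"
  proof (cases "z = 0")
    case True
    then show thesis using m(3) that[of 1] by simp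
  next
    case False
    then have "\<sigma> m \<noteq> 0" using m(3) by auto
    then show thesis using m(3) False that[of "z / \<sigma> m"] by (simp add: norm_divide)
  qed
  then have "Re (cnj e * G z) \<le> Re (cnj e * H (\<sigma> m))"
    using key[OF mI c(1)] by (simp add: algebra_simps)
  then show ?thesis using \<sigma>D[OF mI] by blast
qed

section \<open>The half-plane condition\<close>

text \<open>In the open strip the condition reads \<open>Re w + ln (cos (Im w)) \<ge> ln \<gamma>\<close>, and \<open>- ln \<circ> cos\<close> is convex because
  its derivative \<open>tan\<close> increases. On the edges of the strip \<open>Re (exp w) = 0\<close>, so stating it with the closed strip adds no
  points and makes closedness evident.\<close>

lemma convex_log_of_half_plane:
  assumes "\<gamma> > 0"
  shows "convex {w. \<bar>Im w\<bar> \<le> pi / 2 \<and> Re (exp w) \<ge> \<gamma>}"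
proof -
  let ?I = "{- (pi / 2)<..<pi / 2}"
  have conv: "convex_on ?I (\<lambda>t. - ln (cos t))"
  proof (rule convex_on_realI)
    fix t assume "t \<in> ?I"
    then have "cos t > 0" by (intro cos_gt_zero_pi) auto
    then show "((\<lambda>t. - ln (cos t)) has_real_derivative tan t) (at t)"
      by (auto intro!: derivative_eq_intros simp: tan_def)
  next
    fix s t assume "s \<in> ?I" "t \<in> ?I" "s \<le> t"
    then show "tan s \<le> tan t"
      using tan_monotone[of s t] by (cases "s = t") auto
  qed simp
  have iff: "w \<in> {w. \<bar>Im w\<bar> \<le> pi / 2 \<and> Re (exp w) \<ge> \<gamma>} \<longleftrightarrow> Im w \<in> ?I \<and> ln \<gamma> \<le> Re w + ln (cos (Im w))" for w
  proof (cases "Im w \<in> ?I")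
    case True
    then have c: "cos (Im w) > 0" by (intro cos_gt_zero_pi) auto
    have "\<gamma> \<le> Re (exp w) \<longleftrightarrow> ln \<gamma> \<le> ln (exp (Re w) * cos (Im w))"
      using assms c by (simp add: Re_exp)
    also have "ln (exp (Re w) * cos (Im w)) = Re w + ln (cos (Im w))"
      using c by (subst ln_mult) auto
    finally show ?thesis using True by auto
  next
    case False
    have "\<not> (\<bar>Im w\<bar> \<le> pi / 2 \<and> Re (exp w) \<ge> \<gamma>)"
    proof
      assume *: "\<bar>Im w\<bar> \<le> pi / 2 \<and> Re (exp w) \<ge> \<gamma>"
      then have "Im w = pi / 2 \<or> Im w = - (pi / 2)" using False by auto
      then have "cos (Im w) = 0" by (metis cos_minus cos_pi_half)
      then have "Re (exp w) = 0" by (simp add: Re_exp)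
      then show False using * assms by simp
    qed
    then show ?thesis using False by blast
  qed
  show ?thesis
  proof (rule convexI)
    fix x y :: complex and u v :: real
    assume xy: "x \<in> {w. \<bar>Im w\<bar> \<le> pi / 2 \<and> Re (exp w) \<ge> \<gamma>}" "y \<in> {w. \<bar>Im w\<bar> \<le> pi / 2 \<and> Re (exp w) \<ge> \<gamma>}"
      and uv: "0 \<le> u" "0 \<le> v" "u + v = 1"
    have x: "Im x \<in> ?I" "ln \<gamma> \<le> Re x + ln (cos (Im x))" and y: "Im y \<in> ?I" "ln \<gamma> \<le> Re y + ln (cos (Im y))"
      using xy unfolding iff by auto
    have "convex ?I" by simp
    then have I: "u * Im x + v * Im y \<in> ?I"
      using x(1) y(1) uv unfolding convex_def by (metis real_scaleR_def)
    have "- ln (cos (u * Im x + v * Im y)) \<le> u * - ln (cos (Im x)) + v * - ln (cos (Im y))"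
      using conv x(1) y(1) uv unfolding convex_on_def by (metis real_scaleR_def)
    moreover have "u * ln \<gamma> + v * ln \<gamma> \<le> u * (Re x + ln (cos (Im x))) + v * (Re y + ln (cos (Im y)))"
      using x(2) y(2) uv by (intro add_mono mult_left_mono)
    moreover have "u * ln \<gamma> + v * ln \<gamma> = ln \<gamma>"
      using uv(3) by (metis distrib_right mult_1)
    ultimately show "u *\<^sub>R x + v *\<^sub>R y \<in> {w. \<bar>Im w\<bar> \<le> pi / 2 \<and> Re (exp w) \<ge> \<gamma>}"
      unfolding iff using I by (simp add: algebra_simps)
  qed
qed

lemma closed_log_of_half_plane: "closed {w. \<bar>Im w\<bar> \<le> pi / 2 \<and> Re (exp w) \<ge> \<gamma>}"
  by (intro closed_Collect_conj closed_Collect_le continuous_intros)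

text \<open>The set where \<open>Re (exp w) > 0\<close> falls into parallel strips; a connected set of values containing \<open>0\<close> stays in the central
  one, because it would otherwise meet a line \<open>Im w = \<plusminus> \<pi>/2\<close>, where \<open>Re (exp w) = 0\<close>.\<close>

lemma Im_log_le_half_pi:
  fixes H :: "complex \<Rightarrow> complex"
  assumes "connected S" "continuous_on S H" "a \<in> S" "H a = 0"
    and pos: "\<And>z. z \<in> S \<Longrightarrow> Re (exp (H z)) > 0" and z: "z \<in> S"
  shows "\<bar>Im (H z)\<bar> \<le> pi / 2"
proof (rule ccontr)
  assume big: "\<not> \<bar>Im (H z)\<bar> \<le> pi / 2"
  have "connected ((\<lambda>z. Im (H z)) ` S)"
    using assms by (intro connected_continuous_image continuous_intros)
  then have conn: "t \<in> (\<lambda>z. Im (H z)) ` S"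
    if "x \<in> (\<lambda>z. Im (H z)) ` S" "y \<in> (\<lambda>z. Im (H z)) ` S" "x \<le> t" "t \<le> y" for x y t
    using that connectedD_interval by blast
  have 0: "0 \<in> (\<lambda>z. Im (H z)) ` S"
    using assms(3,4) by (intro image_eqI[of _ _ a]) auto
  have "pi / 2 \<in> (\<lambda>z. Im (H z)) ` S \<or> - (pi / 2) \<in> (\<lambda>z. Im (H z)) ` S"
  proof (cases "Im (H z) \<ge> 0")
    case True
    then show ?thesis using conn[OF 0 imageI[OF z], of "pi / 2"] big by auto
  next
    case False
    then show ?thesis using conn[OF imageI[OF z] 0, of "- (pi / 2)"] big by auto
  qed
  then obtain w where "w \<in> S" "Im (H w) = pi / 2 \<or> Im (H w) = - (pi / 2)" by force
  then have "w \<in> S" "cos (Im (H w)) = 0" by (metis, metis cos_minus cos_pi_half)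
  then show False using pos[of w] by (simp add: Re_exp)
qed

text \<open>The integrand agrees with \<open>H'\<close> except possibly at the initial point of the segment, which does not affect the integral.\<close>

lemma exp_integral_eq:
  assumes H: "H holomorphic_on unit_disc" "H 0 = 0"
    and eq: "\<And>z. z \<in> unit_disc \<Longrightarrow> z * deriv H z = \<phi> z - 1" and z: "z \<in> unit_disc"
  shows "exp_integral \<phi> z = exp (H z)"
proof -
  have "path_image (linepath 0 z) \<subseteq> unit_disc"
    using z by (simp add: closed_segment_subset)
  then have "(deriv H has_contour_integral H (pathfinish (linepath 0 z)) - H (pathstart (linepath 0 z))) (linepath 0 z)"
    by (intro contour_integral_primitive[OF holomorphic_derivI[OF H(1) open_ball] valid_path_linepath])
  then have hd: "(deriv H has_contour_integral H z) (linepath 0 z)"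
    using H(2) by simp
  have "((\<lambda>t. (\<phi> t - 1) / t) has_contour_integral H z) (linepath 0 z)"
  proof (cases "z = 0")
    case True
    then show ?thesis using H(2) by simp
  next
    case False
    have *: "(\<phi> (linepath 0 z x) - 1) / linepath 0 z x = deriv H (linepath 0 z x)" if x: "x \<in> {0..1} - {0}" for x
    proof -
      have "linepath 0 z x \<in> unit_disc"
        using x z closed_segment_subset[of 0 unit_disc z] linepath_in_path[of x 0 z] by auto
      moreover have "linepath 0 z x \<noteq> 0"
        using x False by (simp add: linepath_def)
      ultimately show ?thesis using eq by (metis nonzero_mult_div_cancel_left)
    qed
    show ?thesis
      unfolding has_contour_integral_linepath
      by (rule has_integral_spike_finite[of "{0}", OF _ _ hd[unfolded has_contour_integral_linepath]])
         (use * in auto)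
  qed
  then show ?thesis
    unfolding exp_integral_def by (simp add: contour_integral_unique)
qed

text \<open>The passage from logarithmic derivatives to logarithms: \<open>p = exp G\<close>, and \<open>G\<close> inherits from \<open>H\<close> the
  convex set of admissible values.\<close>

lemma starlike_class_Re_bound:
  assumes \<phi>: "admissible_phi \<phi>" and \<gamma>: "\<gamma> > 0"
    and bound: "\<forall>z\<in>unit_disc. Re (exp_integral \<phi> z) \<ge> \<gamma>"
    and f: "f \<in> starlike_class \<phi>"
  obtains p where "p holomorphic_on unit_disc" "p 0 = 1" "\<And>z. f z = z * p z"
    "\<And>z. z \<in> unit_disc \<Longrightarrow> Re (p z) \<ge> \<gamma>"
proof -
  have f': "f holomorphic_on unit_disc" "f 0 = 0" "deriv f 0 = 1" "inj_on f unit_disc"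
    and sub: "subordinate (log_deriv_quotient f) \<phi>"
    using f by (auto simp: starlike_class_def class_S_def class_A_def)
  obtain p where p: "p holomorphic_on unit_disc" "\<And>z. f z = z * p z" "p 0 = 1"
    using holomorphic_factor_zero[OF f'(1,2)] f'(3) by metis
  have pnz: "p z \<noteq> 0" if "z \<in> unit_disc" for z
  proof (cases "z = 0")
    case False
    then have "f z \<noteq> 0"
      using f'(2,4) that by (metis centre_in_ball inj_on_eq_iff zero_less_one)
    then show ?thesis using p(2)[of z] by auto
  qed (use p(3) in simp)
  define h where "h = (\<lambda>z. \<phi> z - 1)"
  have h: "h holomorphic_on unit_disc" "inj_on h unit_disc" "h 0 = 0"
    using \<phi> unfolding h_def admissible_phi_def by (auto intro!: holomorphic_intros simp: inj_on_def)
  have star: "of_real s * h z \<in> h ` unit_disc" if "z \<in> unit_disc" "0 \<le> s" "s \<le> 1" for z s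
  proof -
    have "1 + of_real s * h z \<in> closed_segment 1 (\<phi> z)"
      unfolding closed_segment_def h_def using that(2,3)
      by (auto simp: scaleR_conv_of_real algebra_simps intro!: exI[of _ s])
    then have "1 + of_real s * h z \<in> \<phi> ` unit_disc"
      using \<phi> that(1) unfolding admissible_phi_def by blast
    then show ?thesis unfolding h_def by (auto simp: image_iff algebra_simps)
  qed
  obtain \<omega> where \<omega>: "\<omega> holomorphic_on unit_disc" "\<omega> ` unit_disc \<subseteq> unit_disc" "\<omega> 0 = 0"
    "\<And>z. z \<in> unit_disc \<Longrightarrow> log_deriv_quotient f z = \<phi> (\<omega> z)"
    using sub unfolding subordinate_def by blast
  have \<omega>_le: "cmod (\<omega> z) \<le> cmod z" if "z \<in> unit_disc" for z
  proof (rule Schwarz_Lemma(1)[OF \<omega>(1,3)])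
    show "cmod (\<omega> x) < 1" if "cmod x < 1" for x using \<omega>(2) that by (auto simp: image_subset_iff)
  qed (use that in simp)
  obtain H where H: "H holomorphic_on unit_disc" "H 0 = 0" "\<And>z. z \<in> unit_disc \<Longrightarrow> z * deriv H z = h z"
    using Euler_primitive[OF h(1,3)] by metis
  obtain L where L: "L holomorphic_on unit_disc" "\<And>z. z \<in> unit_disc \<Longrightarrow> exp (L z) = p z"
    using holomorphic_logarithm_exists[OF convex_ball open_ball p(1) pnz, of 0] by auto
  define G where "G = (\<lambda>z. L z - L 0)"
  have G: "G holomorphic_on unit_disc" "G 0 = 0"
    unfolding G_def using L(1) by (auto intro!: holomorphic_intros)
  have exp_G: "exp (G z) = p z" if "z \<in> unit_disc" for z
    using L(2)[OF that] L(2)[of 0] p(3) by (simp add: G_def exp_diff)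
  have G_eq: "z * deriv G z = h (\<omega> z)" if z: "z \<in> unit_disc" for z
  proof (cases "z = 0")
    case True
    then show ?thesis using \<omega>(3) h(3) by simp
  next
    case False
    have "((\<lambda>w. w * exp (G w)) has_field_derivative exp (G z) * (1 + z * deriv G z)) (at z)"
      using holomorphic_derivI[OF G(1) open_ball z]
      by (auto intro!: derivative_eq_intros simp: algebra_simps)
    then have "(f has_field_derivative p z * (1 + z * deriv G z)) (at z)"
      using z exp_G p(2)
      by (auto elim!: has_field_derivative_transform_within_open[OF _ open_ball z])
    then have "log_deriv_quotient f z = 1 + z * deriv G z"
      using False p(2)[of z] pnz[OF z] by (simp add: log_deriv_quotient_def DERIV_imp_deriv)
    then show ?thesis using \<omega>(4)[OF z] by (simp add: h_def)
  qed
  define W where "W = {w. \<bar>Im w\<bar> \<le> pi / 2 \<and> Re (exp w) \<ge> \<gamma>}"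
  have HW: "H z \<in> W" if "z \<in> unit_disc" for z
  proof -
    have Re_ge: "Re (exp (H y)) \<ge> \<gamma>" if "y \<in> unit_disc" for y
      using exp_integral_eq[OF H(1,2) _ that, of \<phi>] H(3) bspec[OF bound that] by (simp add: h_def)
    have "\<bar>Im (H z)\<bar> \<le> pi / 2"
    proof (rule Im_log_le_half_pi[OF _ holomorphic_on_imp_continuous_on[OF H(1)] _ H(2) _ that])
      show "Re (exp (H y)) > 0" if "y \<in> unit_disc" for y using Re_ge[OF that] \<gamma> by simp
    qed auto
    then show ?thesis using Re_ge[OF that] by (simp add: W_def)
  qed
  have GW: "G z \<in> W" if z: "z \<in> unit_disc" for z
  proof (rule ccontr)
    assume "G z \<notin> W"
    then obtain a b where ab: "inner a (G z) < b" "\<And>x. x \<in> W \<Longrightarrow> inner a x > b"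
      using separating_hyperplane_closed_point[of W "G z"]
        convex_log_of_half_plane[OF \<gamma>] closed_log_of_half_plane unfolding W_def by metis
    obtain w where w: "w \<in> unit_disc" "Re (cnj (- a) * G z) \<le> Re (cnj (- a) * H w)"
      using subordinate_support_le[OF h star H G G_eq \<omega>_le z, of "- a"] by blast
    then have "inner a (H w) \<le> inner a (G z)" by (simp add: inner_complex_def)
    then show False using ab HW[OF w(1)] by force
  qed
  show thesis
  proof
    show "Re (p z) \<ge> \<gamma>" if "z \<in> unit_disc" for z
      using GW[OF that] exp_G[OF that] by (simp add: W_def)
  qed (use p in auto)
qed

section \<open>Starlike functions\<close>

text \<open>The hypotheses \<open>K = w p K'\<close> and \<open>Re p > 0\<close> say that \<open>w K'/K\<close> has positive real part at \<open>w\<close>. Following the local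
  inverse of \<open>K\<close>, the curve \<open>y(s) = K\<^sup>-\<^sup>1(s K(w))\<close> has \<open>y(1) = w\<close> and \<open>y'(1) = w p\<close>, so \<open>|y|\<^sup>2\<close> has derivative
  \<open>2 |w|\<^sup>2 Re p > 0\<close> at \<open>s = 1\<close>: shrinking the value slightly moves the point inwards.\<close>

lemma starlike_local_descent:
  fixes K :: "complex \<Rightarrow> complex"
  assumes K: "K holomorphic_on unit_disc"
    and w: "w \<in> unit_disc" "w \<noteq> 0"
    and d: "deriv K w \<noteq> 0" "K w = w * p * deriv K w" "Re p > 0"
    and V: "open V" "w \<in> V"
  shows "\<forall>\<^sub>F s in at_left 1. \<exists>v\<in>V \<inter> unit_disc. cmod v < cmod w \<and> K v = of_real s * K w"
proof -
  have "K holomorphic_on V \<inter> unit_disc" "open (V \<inter> unit_disc)" "w \<in> V \<inter> unit_disc"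
    using K V w by (auto intro: holomorphic_on_subset)
  then obtain r where r: "r > 0" "ball w r \<subseteq> V \<inter> unit_disc" "inj_on K (ball w r)"
    using has_complex_derivative_locally_injective[of K "V \<inter> unit_disc" w] d(1) by blast
  have Kr: "K holomorphic_on ball w r"
    using K r(2) by (auto intro: holomorphic_on_subset)
  obtain k where k: "k holomorphic_on K ` ball w r"
     "\<And>z. z \<in> ball w r \<Longrightarrow> deriv K z * deriv k (K z) = 1" "\<And>z. z \<in> ball w r \<Longrightarrow> k (K z) = z"
    using holomorphic_has_inverse[OF Kr open_ball r(3)] by blast
  have op: "open (K ` ball w r)"
    by (rule open_mapping_thm3[OF Kr open_ball r(3)])
  have wr: "w \<in> ball w r" using r(1) by simp
  define y where "y = (\<lambda>s::real. k (of_real s * K w))"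
  have "(k has_field_derivative deriv k (K w)) (at (of_real 1 * K w))"
    using holomorphic_derivI[OF k(1) op, of "K w"] wr by auto
  then have "((\<lambda>x. k (x * K w)) has_field_derivative deriv k (K w) * K w) (at (of_real 1))"
    by (auto intro!: derivative_eq_intros DERIV_chain2[where f = k])
  then have "(y has_vector_derivative deriv k (K w) * K w) (at 1)"
    unfolding y_def by (rule has_vector_derivative_real_field)
  moreover have "deriv k (K w) * K w = w * p"
    using k(2)[OF wr] d(2) by (simp add: algebra_simps)
  moreover have y1: "y 1 = w"
    using k(3)[OF wr] by (simp add: y_def)
  ultimately have "((\<lambda>t. (cmod (y t))\<^sup>2) has_real_derivative 2 * Re (cnj w * (w * p))) (at 1)"
    using has_real_derivative_cmod_power2[of y "w * p" 1] by simp
  moreover have "Re (cnj w * (w * p)) = (cmod w)\<^sup>2 * Re p"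
    unfolding cmod_power2 by (simp add: algebra_simps power2_eq_square)
  then have "Re (cnj w * (w * p)) > 0"
    using d(3) w(2) by (metis mult_pos_pos zero_less_norm_iff zero_less_power)
  ultimately have "\<exists>d>0. \<forall>h>0. h < d \<longrightarrow> (cmod (y (1 - h)))\<^sup>2 < (cmod (y 1))\<^sup>2"
    by (intro DERIV_pos_inc_left[where l = "2 * Re (cnj w * (w * p))"]) simp_all
  then obtain \<delta> where \<delta>: "\<delta> > 0" "\<And>h. h > 0 \<Longrightarrow> h < \<delta> \<Longrightarrow> (cmod (y (1 - h)))\<^sup>2 < (cmod w)\<^sup>2"
    unfolding y1 by blast
  have "\<forall>\<^sub>F s in at_left (1::real). 1 - \<delta> < s \<and> s < 1"
    unfolding eventually_at_left_field using \<delta>(1) by (intro exI[of _ "1 - \<delta>"]) auto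
  moreover have "((\<lambda>s. of_real s * K w) \<longlongrightarrow> of_real 1 * K w) (at_left (1::real))"
    by (intro tendsto_intros)
  then have "\<forall>\<^sub>F s in at_left (1::real). of_real s * K w \<in> K ` ball w r"
    using topological_tendstoD[OF _ op] wr by fastforce
  ultimately show ?thesis
  proof eventually_elim
    case (elim s)
    then have "(cmod (y s))\<^sup>2 < (cmod w)\<^sup>2"
      using \<delta>(2)[of "1 - s"] by simp
    then have "cmod (y s) < cmod w"
      by (rule power2_less_imp_less) simp
    then show ?case
      using elim k(3) r(2) by (intro bexI[of _ "y s"]) (auto simp: y_def)
  qed
qed

text \<open>If \<open>K\<close> were not injective, then the pairs of distinct points of some closed disc with equal values would form a nonempty
  set, which is compact because local injectivity keeps these pairs away from the diagonal. In a pair of least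
  total modulus both points can be moved inwards so that their values shrink by the same factor, which
  contradicts minimality.\<close>

lemma starlike_imp_inj_on:
  fixes K :: "complex \<Rightarrow> complex"
  assumes K: "K holomorphic_on unit_disc"
    and d: "\<And>z. z \<in> unit_disc \<Longrightarrow> deriv K z \<noteq> 0"
    and eq: "\<And>z. z \<in> unit_disc \<Longrightarrow> K z = z * p z * deriv K z"
    and p: "\<And>z. z \<in> unit_disc \<Longrightarrow> Re (p z) > 0"
  shows "inj_on K unit_disc"
proof (rule ccontr)
  assume "\<not> inj_on K unit_disc"
  then obtain a b where ab: "a \<in> unit_disc" "b \<in> unit_disc" "K a = K b" "a \<noteq> b"
    unfolding inj_on_def by blast
  have K0: "K z = 0 \<longleftrightarrow> z = 0" if "z \<in> unit_disc" for z
    using eq[OF that] d[OF that] p[OF that] by auto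
  define \<rho> where "\<rho> = max (cmod a) (cmod b)"
  have \<rho>: "\<rho> < 1" "a \<in> cball 0 \<rho>" "b \<in> cball 0 \<rho>"
    using ab by (auto simp: \<rho>_def)
  have sub: "cball 0 \<rho> \<subseteq> unit_disc" using \<rho>(1) by auto
  have contK: "continuous_on (cball 0 \<rho>) K"
    using K sub holomorphic_on_imp_continuous_on continuous_on_subset by blast
  \<comment> \<open>An open neighbourhood of the diagonal that contains no pair of distinct points with equal values.\<close>
  define U where "U = \<Union>{V \<times> V |V. open V \<and> inj_on K V}"
  define E where "E = {z \<in> cball 0 \<rho> \<times> cball 0 \<rho>. K (fst z) = K (snd z)}"
  have "open U"
    unfolding U_def by (auto intro!: open_Union open_Times)
  have "E = {z \<in> cball 0 \<rho> \<times> cball 0 \<rho>. K (fst z) - K (snd z) = 0}"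
    unfolding E_def by auto
  then have "closed E"
    by (simp only:)
       (intro continuous_closed_preimage_constant continuous_intros
          continuous_on_compose2[OF contK] closed_Times; auto)
  moreover have "bounded E"
    by (rule bounded_subset[of "cball 0 \<rho> \<times> cball 0 \<rho>"]) (auto simp: E_def intro: bounded_Times)
  ultimately have "compact (E - U)"
    using \<open>open U\<close> by (intro compact_diff) (auto simp: compact_eq_bounded_closed)
  have ne: "x \<noteq> y \<longleftrightarrow> (x, y) \<notin> U" if x: "x \<in> unit_disc" and "y \<in> unit_disc" "K x = K y" for x y
  proof
    assume "x \<noteq> y" then show "(x, y) \<notin> U"
      using x that by (auto simp: U_def inj_on_def)
  next
    assume *: "(x, y) \<notin> U"
    show "x \<noteq> y"
    proof
      assume "x = y"
      obtain r where "r > 0" "inj_on K (ball x r)"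
        using has_complex_derivative_locally_injective[OF K x open_ball d[OF x]] by metis
      then have "(x, x) \<in> U"
        unfolding U_def by (intro UnionI[of "ball x r \<times> ball x r"]) auto
      then show False using * \<open>x = y\<close> by simp
    qed
  qed
  have abE: "(a, b) \<in> E - U"
    using ab \<rho> ne[of a b] by (auto simp: E_def)
  have "continuous_on (E - U) (\<lambda>z. cmod (fst z) + cmod (snd z))"
    by (intro continuous_intros)
  then obtain m where m: "m \<in> E - U"
     "\<And>z. z \<in> E - U \<Longrightarrow> cmod (fst m) + cmod (snd m) \<le> cmod (fst z) + cmod (snd z)"
    using continuous_attains_inf[OF \<open>compact (E - U)\<close>] abE by blast
  obtain x y where xy: "m = (x, y)" by (cases m)
  have x: "x \<in> unit_disc" "cmod x \<le> \<rho>" and y: "y \<in> unit_disc" "cmod y \<le> \<rho>" and Kxy: "K x = K y"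
    using m(1) xy sub by (auto simp: E_def)
  have "x \<noteq> y" using ne[OF x(1) y(1) Kxy] m(1) xy by simp
  then have nz: "x \<noteq> 0" "y \<noteq> 0"
    using K0[OF x(1)] K0[OF y(1)] Kxy by auto
  obtain X Y where XY: "open X" "open Y" "x \<in> X" "y \<in> Y" "X \<inter> Y = {}"
    using hausdorff[OF \<open>x \<noteq> y\<close>] by blast
  have "\<forall>\<^sub>F s in at_left 1. (\<exists>v\<in>X \<inter> unit_disc. cmod v < cmod x \<and> K v = of_real s * K x) \<and>
                            (\<exists>v\<in>Y \<inter> unit_disc. cmod v < cmod y \<and> K v = of_real s * K y)"
    using starlike_local_descent[OF K x(1) nz(1) d[OF x(1)] eq[OF x(1)] p[OF x(1)] XY(1,3)]
          starlike_local_descent[OF K y(1) nz(2) d[OF y(1)] eq[OF y(1)] p[OF y(1)] XY(2,4)]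
    by (rule eventually_conj)
  then obtain s :: real where "(\<exists>v\<in>X \<inter> unit_disc. cmod v < cmod x \<and> K v = of_real s * K x) \<and>
                            (\<exists>v\<in>Y \<inter> unit_disc. cmod v < cmod y \<and> K v = of_real s * K y)"
    using eventually_happens trivial_limit_at_left_real by blast
  then obtain v v' where v: "v \<in> X" "v \<in> unit_disc" "cmod v < cmod x" "K v = of_real s * K x"
    and v': "v' \<in> Y" "v' \<in> unit_disc" "cmod v' < cmod y" "K v' = of_real s * K y"
    by blast
  have "v \<noteq> v'" using v(1) v'(1) XY(5) by auto
  then have "(v, v') \<in> E - U"
    using ne[OF v(2) v'(2)] v v' x y Kxy by (auto simp: E_def)
  then show False
    using m(2)[of "(v, v')"] xy v(3) v'(3) by simp
qed

text \<open>Consider the least \<open>t\<close> in \<open>[s, 1]\<close> for which \<open>t K(z)\<close> is attained on the closed disc of radius \<open>|z|\<close>. If \<open>t\<close> were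
  greater than \<open>s\<close>, a local descent from the point that attains it would produce a smaller one.\<close>

lemma starlike_scaled_value:
  fixes K :: "complex \<Rightarrow> complex"
  assumes K: "K holomorphic_on unit_disc"
    and d: "\<And>z. z \<in> unit_disc \<Longrightarrow> deriv K z \<noteq> 0"
    and eq: "\<And>z. z \<in> unit_disc \<Longrightarrow> K z = z * p z * deriv K z"
    and p: "\<And>z. z \<in> unit_disc \<Longrightarrow> Re (p z) > 0"
    and z: "z \<in> unit_disc" and s: "0 < s" "s \<le> 1"
  shows "of_real s * K z \<in> K ` unit_disc"
proof -
  define C where "C = K ` cball 0 (cmod z)"
  have sub: "cball 0 (cmod z) \<subseteq> unit_disc" using z by auto
  have "compact C"
    unfolding C_def using K sub
    by (intro compact_continuous_image compact_cball)
       (meson holomorphic_on_imp_continuous_on continuous_on_subset)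
  define T where "T = {s..1} \<inter> (\<lambda>t. of_real t * K z) -` C"
  have "closed T"
    unfolding T_def using \<open>compact C\<close>
    by (intro continuous_closed_preimage continuous_intros compact_imp_closed) auto
  then have "compact T"
    unfolding T_def by (meson compact_Icc closed_Int_compact compact_eq_bounded_closed inf_le1 bounded_subset)
  moreover have "1 \<in> T" using s by (auto simp: T_def C_def)
  ultimately obtain t where t: "t \<in> T" "\<And>t'. t' \<in> T \<Longrightarrow> t \<le> t'"
    using compact_attains_inf[of T] by blast
  then obtain w where w: "cmod w \<le> cmod z" "K w = of_real t * K z" and ts: "s \<le> t" "t \<le> 1"
    by (auto simp: T_def C_def)
  have wD: "w \<in> unit_disc" using w(1) z by simp
  have "t = s"
  proof (rule ccontr)
    assume "t \<noteq> s"
    then have "s < t" using ts by simp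
    show False
    proof (cases "w = 0")
      case True
      then have "K w = 0" using eq[OF wD] by simp
      then have "K z = 0" using w ts s by simp
      then have "s \<in> T" using eq[of 0] s by (auto simp: T_def C_def intro!: image_eqI[of _ _ 0])
      then show False using t(2) \<open>s < t\<close> by force
    next
      case False
      have "\<forall>\<^sub>F r in at_left 1. \<exists>v\<in>UNIV \<inter> unit_disc. cmod v < cmod w \<and> K v = of_real r * K w"
        by (rule starlike_local_descent[OF K wD False d[OF wD] eq[OF wD] p[OF wD]]) auto
      moreover have "\<forall>\<^sub>F r in at_left (1::real). s / t < r \<and> r < 1"
        unfolding eventually_at_left_field using \<open>s < t\<close> s by (intro exI[of _ "s / t"]) auto
      ultimately have "\<forall>\<^sub>F r in at_left 1. (\<exists>v\<in>UNIV \<inter> unit_disc. cmod v < cmod w \<and> K v = of_real r * K w)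
           \<and> s / t < r \<and> r < 1"
        by (rule eventually_conj)
      then obtain r :: real where "(\<exists>v\<in>UNIV \<inter> unit_disc. cmod v < cmod w \<and> K v = of_real r * K w)
           \<and> s / t < r \<and> r < 1"
        using eventually_happens trivial_limit_at_left_real by blast
      then obtain v where v: "cmod v < cmod w" "K v = of_real r * K w" and r: "s / t < r" "r < 1"
        by blast
      have "s < r * t" "r * t < t"
        using r ts s by (auto simp: field_simps)
      moreover have "of_real (r * t) * K z \<in> C"
        unfolding C_def using v w by (intro image_eqI[of _ _ v]) auto
      ultimately have "r * t \<in> T" using ts by (auto simp: T_def)
      then show False using t(2) \<open>r * t < t\<close> by force
    qed
  qed
  then show ?thesis using w wD by (metis imageI)
qed

section \<open>The semigroup of a generator\<close>

text \<open>For \<open>f(z) = z p(z)\<close> the last property is \<open>K = f K'\<close>: along the flow of \<open>- f\<close> the function \<open>K\<close> decays like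
  \<open>e\<^sup>-\<^sup>t\<close>. With \<open>K = z exp B\<close> it amounts to \<open>1 + z B' = 1/p\<close>.\<close>

lemma Koenigs_function:
  assumes p: "p holomorphic_on unit_disc" "p 0 = 1" "\<And>z. z \<in> unit_disc \<Longrightarrow> p z \<noteq> 0"
  obtains K where "K holomorphic_on unit_disc" "\<And>z. z \<in> unit_disc \<Longrightarrow> deriv K z \<noteq> 0"
    "\<And>z. z \<in> unit_disc \<Longrightarrow> K z = z * p z * deriv K z"
proof -
  have "(\<lambda>z. 1 / p z - 1) holomorphic_on unit_disc"
    using p by (intro holomorphic_intros) auto
  then obtain B where B: "B holomorphic_on unit_disc" "\<And>z. z \<in> unit_disc \<Longrightarrow> z * deriv B z = 1 / p z - 1"
    using Euler_primitive[of "\<lambda>z. 1 / p z - 1"] p(2) by auto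
  define K where "K = (\<lambda>z. z * exp (B z))"
  have dK: "deriv K z = exp (B z) / p z" if z: "z \<in> unit_disc" for z
  proof -
    have "(K has_field_derivative exp (B z) + z * (exp (B z) * deriv B z)) (at z)"
      unfolding K_def using holomorphic_derivI[OF B(1) open_ball z]
      by (auto intro!: derivative_eq_intros)
    moreover have "exp (B z) + z * (exp (B z) * deriv B z) = exp (B z) * (1 + z * deriv B z)"
      by (simp add: algebra_simps)
    ultimately show ?thesis
      using B(2)[OF z] by (simp add: DERIV_imp_deriv)
  qed
  show thesis
  proof
    show "K holomorphic_on unit_disc"
      unfolding K_def using B(1) by (intro holomorphic_intros)
  qed (use dK p(3) in \<open>auto simp: K_def\<close>)
qed

text \<open>In the coordinate \<open>K\<close> the semigroup is multiplication by \<open>e\<^sup>-\<^sup>t\<close>. For an arbitrary solution \<open>v\<close> the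
  product \<open>e\<^sup>t K(v(t))\<close> is constant, so injectivity of \<open>K\<close> gives uniqueness.\<close>

lemma semigroup_with_decay:
  assumes p: "p holomorphic_on unit_disc" "p 0 = 1"
    and Re_p: "\<And>z. z \<in> unit_disc \<Longrightarrow> Re (p z) \<ge> \<gamma>" and "\<gamma> > 0"
    and f: "\<And>z. z \<in> unit_disc \<Longrightarrow> f z = z * p z"
  shows "\<exists>u. generates_semigroup f u \<and>
     (\<forall>t\<ge>0. \<forall>z\<in>unit_disc. cmod (u t z) \<le> exp (- t * \<gamma>) * cmod z)"
proof -
  have pos: "Re (p z) > 0" if "z \<in> unit_disc" for z
    using Re_p[OF that] \<open>\<gamma> > 0\<close> by simp
  then have "p z \<noteq> 0" if "z \<in> unit_disc" for z
    using that by force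
  then obtain K where K: "K holomorphic_on unit_disc" "\<And>z. z \<in> unit_disc \<Longrightarrow> deriv K z \<noteq> 0"
    "\<And>z. z \<in> unit_disc \<Longrightarrow> K z = z * p z * deriv K z"
    using Koenigs_function[OF p] by blast
  have inj: "inj_on K unit_disc"
    by (rule starlike_imp_inj_on[OF K pos])
  obtain k where k: "k holomorphic_on K ` unit_disc"
     "\<And>z. z \<in> unit_disc \<Longrightarrow> deriv K z * deriv k (K z) = 1" "\<And>z. z \<in> unit_disc \<Longrightarrow> k (K z) = z"
    using holomorphic_has_inverse[OF K(1) open_ball inj] by blast
  have op: "open (K ` unit_disc)"
    by (rule open_mapping_thm3[OF K(1) open_ball inj])
  define u where "u = (\<lambda>(t::real) z. k (of_real (exp (- t)) * K z))"
  have KuD: "of_real (exp (- t)) * K z \<in> K ` unit_disc" if "t \<ge> 0" "z \<in> unit_disc" for t z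
    using that by (intro starlike_scaled_value[OF K pos]) auto
  have uD: "u t z \<in> unit_disc" and Ku: "K (u t z) = of_real (exp (- t)) * K z"
    if "t \<ge> 0" "z \<in> unit_disc" for t z
    using KuD[OF that] k(3) unfolding u_def by (metis (no_types, lifting) imageE)+
  have deriv_u: "((\<lambda>s. u s z) has_vector_derivative - f (u t z)) (at t)" if tz: "t \<ge> 0" "z \<in> unit_disc" for t z
  proof -
    have ex: "exp (- complex_of_real x) = of_real (exp (- x))" for x
      by (simp flip: exp_of_real)
    have "(k has_field_derivative deriv k (K (u t z))) (at (exp (- of_real t) * K z))"
      using holomorphic_derivI[OF k(1) op KuD[OF tz]] Ku[OF tz] by (simp add: ex)
    then have "((\<lambda>x. k (exp (- x) * K z)) has_field_derivative
                 deriv k (K (u t z)) * - (exp (- of_real t) * K z)) (at (of_real t))"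
      by (rule DERIV_chain2) (auto intro!: derivative_eq_intros)
    then have "((\<lambda>s. k (exp (- of_real s) * K z)) has_vector_derivative
                 deriv k (K (u t z)) * - (exp (- of_real t) * K z)) (at t)"
      by (rule has_vector_derivative_real_field)
    moreover have "exp (- of_real t) * K z = f (u t z) * deriv K (u t z)"
      using Ku[OF tz] K(3)[OF uD[OF tz]] f[OF uD[OF tz]] by (simp add: ex)
    then have "deriv k (K (u t z)) * - (exp (- of_real t) * K z)
        = - f (u t z) * (deriv K (u t z) * deriv k (K (u t z)))"
      by simp
    ultimately show ?thesis
      unfolding k(2)[OF uD[OF tz]] by (simp add: u_def ex)
  qed
  have u0: "u 0 z = z" if "z \<in> unit_disc" for z
    using k(3)[OF that] by (simp add: u_def)
  have hol_u: "u t holomorphic_on unit_disc" if "t \<ge> 0" for t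
    unfolding u_def
    using KuD[OF that] K(1) by (intro holomorphic_on_compose_gen[OF _ k(1), unfolded o_def] holomorphic_intros) auto
  have unique: "v t z = u t z" if v: "solves_semigroup_ode f v" and tz: "t \<ge> 0" "z \<in> unit_disc" for v t z
  proof -
    have vD: "v s z \<in> unit_disc" and v0: "v 0 z = z"
      and v': "((\<lambda>s. v s z) has_vector_derivative - f (v s z)) (at s within {0..})" if "s \<ge> 0" for s
      using v tz(2) that unfolding solves_semigroup_ode_def by auto
    have der: "((\<lambda>s. of_real (exp s) * K (v s z)) has_vector_derivative 0) (at s within {0..})" if "s \<ge> 0" for s
    proof -
      have "((K \<circ> (\<lambda>s. v s z)) has_vector_derivative - f (v s z) * deriv K (v s z)) (at s within {0..})"
        using holomorphic_derivI[OF K(1) open_ball vD[OF that]]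
        by (intro field_vector_diff_chain_within v' that) 
      then have "((\<lambda>s. K (v s z)) has_vector_derivative - K (v s z)) (at s within {0..})"
        using K(3)[OF vD[OF that]] f[OF vD[OF that]] by (simp add: o_def)
      moreover have "((\<lambda>s. of_real (exp s)) has_vector_derivative complex_of_real (exp s)) (at s within {0..})"
        by (intro has_vector_derivative_of_real derivative_eq_intros) auto
      ultimately show ?thesis
        using has_vector_derivative_mult[of "\<lambda>s. of_real (exp s)" "of_real (exp s)" s "{0..}" "\<lambda>s. K (v s z)" "- K (v s z)"]
        by simp
    qed
    have "\<exists>c. \<forall>s\<in>{0..}. of_real (exp s) * K (v s z) = c"
      using der by (intro has_derivative_zero_constant) (auto simp: has_vector_derivative_def)
    then have "of_real (exp t) * K (v t z) = K z"
      using tz v0 by force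
    then have "of_real (exp t) * K (v t z) = of_real (exp t) * K (u t z)"
      using Ku[OF tz] by (simp add: exp_minus field_simps)
    then have "K (v t z) = K (u t z)"
      by simp
    then show ?thesis
      using inj vD[OF tz(1)] uD[OF tz] by (simp add: inj_on_eq_iff)
  qed
  have decay: "cmod (u t z) \<le> exp (- t * \<gamma>) * cmod z" if tz: "t \<ge> 0" "z \<in> unit_disc" for t z
  proof -
    have "exp (2 * \<gamma> * t) * (cmod (u t z))\<^sup>2 \<le> exp (2 * \<gamma> * 0) * (cmod (u 0 z))\<^sup>2"
    proof (rule DERIV_nonpos_imp_nonincreasing[OF tz(1)])
      fix s :: real assume s: "0 \<le> s" "s \<le> t"
      define w where "w = u s z"
      have wD: "w \<in> unit_disc" using uD[OF s(1) tz(2)] by (simp add: w_def)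
      have "Re (cnj w * - f w) = - ((cmod w)\<^sup>2 * Re (p w))"
        using f[OF wD] unfolding cmod_power2 by (simp add: algebra_simps power2_eq_square)
      then have "((\<lambda>s. (cmod (u s z))\<^sup>2) has_real_derivative - 2 * ((cmod w)\<^sup>2 * Re (p w))) (at s)"
        using has_real_derivative_cmod_power2[OF deriv_u[OF s(1) tz(2)]] by (simp add: w_def)
      moreover have "((\<lambda>s. exp (2 * \<gamma> * s)) has_real_derivative exp (2 * \<gamma> * s) * (2 * \<gamma>)) (at s)"
        by (auto intro!: derivative_eq_intros)
      ultimately have "((\<lambda>s. exp (2 * \<gamma> * s) * (cmod (u s z))\<^sup>2) has_real_derivative
           exp (2 * \<gamma> * s) * (2 * \<gamma>) * (cmod w)\<^sup>2 + - 2 * ((cmod w)\<^sup>2 * Re (p w)) * exp (2 * \<gamma> * s)) (at s)"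
        unfolding w_def by (intro DERIV_mult)
      then have "((\<lambda>s. exp (2 * \<gamma> * s) * (cmod (u s z))\<^sup>2) has_real_derivative
           exp (2 * \<gamma> * s) * (2 * (cmod w)\<^sup>2) * (\<gamma> - Re (p w))) (at s)"
        by (simp add: algebra_simps)
      moreover have "exp (2 * \<gamma> * s) * (2 * (cmod w)\<^sup>2) * (\<gamma> - Re (p w)) \<le> 0"
        using Re_p[OF wD] by (intro mult_nonneg_nonpos) auto
      ultimately show "\<exists>y. ((\<lambda>s. exp (2 * \<gamma> * s) * (cmod (u s z))\<^sup>2) has_real_derivative y) (at s) \<and> y \<le> 0"
        by blast
    qed
    then have "(exp (\<gamma> * t) * cmod (u t z))\<^sup>2 \<le> (cmod z)\<^sup>2"
      using u0[OF tz(2)] by (simp add: power_mult_distrib flip: exp_double) (simp add: mult_ac)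
    then have "exp (\<gamma> * t) * cmod (u t z) \<le> cmod z"
      by (rule power2_le_imp_le) simp
    then show ?thesis
      by (simp add: exp_minus field_simps)
  qed
  have "solves_semigroup_ode f u"
    unfolding solves_semigroup_ode_def
    using uD u0 deriv_u by (auto intro: has_vector_derivative_at_within)
  then have "generates_semigroup f u"
    unfolding generates_semigroup_def using hol_u uD unique by blast
  then show ?thesis using decay by blast
qed

section \<open>Starlike classes and infinitesimal generators\<close>

theorem theorem3p4:
  fixes \<phi> :: "complex \<Rightarrow> complex" and \<gamma> :: real
  assumes "admissible_phi \<phi>"
    and "\<gamma> > 0"
    and "\<forall>z\<in>unit_disc. Re (exp_integral \<phi> z) \<ge> \<gamma>"
  shows "starlike_class \<phi> \<subseteq> class_G0 \<and>
    (\<forall>f\<in>starlike_class \<phi>. \<exists>u. generates_semigroup f u \<and>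
       (\<forall>t\<ge>0. \<forall>z\<in>unit_disc. cmod (u t z) \<le> exp (- t * \<gamma>) * cmod z))"
proof (intro conjI subsetI ballI)
  fix f assume f: "f \<in> starlike_class \<phi>"
  obtain p where p: "p holomorphic_on unit_disc" "p 0 = 1" "\<And>z. f z = z * p z"
    "\<And>z. z \<in> unit_disc \<Longrightarrow> Re (p z) \<ge> \<gamma>"
    using starlike_class_Re_bound[OF assms f] by blast
  have "f \<in> class_A" using f by (simp add: starlike_class_def class_S_def)
  moreover have "\<forall>z\<in>unit_disc. f z = z * p z \<and> Re (p z) > 0"
    using p(3,4) assms(2) by force
  ultimately show "f \<in> class_G0"
    unfolding class_G0_def using p(1) by blast
  show "\<exists>u. generates_semigroup f u \<and>
       (\<forall>t\<ge>0. \<forall>z\<in>unit_disc. cmod (u t z) \<le> exp (- t * \<gamma>) * cmod z)"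
    by (rule semigroup_with_decay[OF p(1,2,4) assms(2) p(3)])
qed

end
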